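(* Let $Q$ and $GM$ be two geometries with Z-address intervals $Zitvl_Q = [Zmin_Q, Zmax_Q]$ and $Zitvl_{GM} = [Zmin_{GM}, Zmax_{GM}]$. If $Q$ intersects $GM$, then $Zitvl_Q$ intersects $Zitvl_{GM}$, i.e. $$Zmin_Q \le Zmax_{GM} \quad\text{and}\quad Zmax_Q \ge Zmin_{GM}.$$
   Context: A geometry is a nonempty closed bounded planar set of points (longitude, latitude) in $[-180,180]\times[-90,90]$ (a point, line string, polygon, or finite collection of these). Intersects: "$Q$ intersects $GM$" holds if $Q$ and $GM$ share any portion of space, i.e. $Q\cap GM\neq\emptyset$. Minimum bounding rectangle (MBR): the MBR of a geometry is given by the two points $p_{min}=(x_{min},y_{min})$ and $p_{max}=(x_{max},y_{max})$, where $x_{min},x_{max},y_{min},y_{max}$ are the minimum and maximum values of the first and second coordinates over the geometry. Z-address: fix a cell size $c>0$ (the same for all geometries; e.g. $c=5\times 10^{-7}$). A point (longitude, latitude) is mapped to the non-negative integer coordinates $x=\lfloor(\text{longitude}+180)/c\rfloor$, $y=\lfloor(\text{latitude}+90)/c\rfloor$. Its Z-address is the non-negative integer obtained by interleaving the binary digits of $x$ and $y$: if $x=\sum_i x_i2^i$ and $y=\sum_i y_i2^i$ with $x_i,y_i\in\{0,1\}$, the Z-address is $\sum_i (x_i 2^{2i}+y_i2^{2i+1})$ (for example, the integer coordinates $(0,1)$ have Z-address $2$). Z-address interval: for a geometry $G$ with MBR points $p_{min}$ and $p_{max}$, $Zmin_G$ is the Z-address of $p_{min}$, $Zmax_G$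 is the Z-address of $p_{max}$, and $Zitvl_G=[Zmin_G,Zmax_G]$ (an interval of integers). *)

theory Defs
  imports "HOL-Analysis.Analysis"
begin

text \<open>
  Points are pairs (longitude, latitude). The point set is not restricted to finite unions of
  points, line strings and polygons: every nonempty compact subset of the coordinate rectangle
  is admitted, so those shapes are special cases.
\<close>

definition geometry :: "(real \<times> real) set \<Rightarrow> bool" where
  "geometry G \<longleftrightarrow>
     G \<noteq> {} \<and> closed G \<and> bounded G \<and> G \<subseteq> {-180..180} \<times> {-90..90}"

definition intersects :: "'a set \<Rightarrow> 'a set \<Rightarrow> bool" where
  "intersects A B \<longleftrightarrow> A \<inter> B \<noteq> {}"

text \<open>
  \<open>Min\<close> and \<open>Max\<close> only apply to finite sets, so the minimum and maximum
  coordinates are taken with \<open>LEAST\<close> and \<open>GREATEST\<close>; that these are attained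
  on a geometry is \<open>geometry_coord_extrema\<close> below.
\<close>

definition mbr_min :: "(real \<times> real) set \<Rightarrow> real \<times> real" where
  "mbr_min G = (LEAST x. x \<in> fst ` G, LEAST y. y \<in> snd ` G)"

definition mbr_max :: "(real \<times> real) set \<Rightarrow> real \<times> real" where
  "mbr_max G = (GREATEST x. x \<in> fst ` G, GREATEST y. y \<in> snd ` G)"

lemma compact_Least_Greatest:
  fixes S :: "real set"
  assumes "compact S" "S \<noteq> {}"
  shows "(LEAST x. x \<in> S) \<in> S" "(GREATEST x. x \<in> S) \<in> S"
    and "\<And>s. s \<in> S \<Longrightarrow> (LEAST x. x \<in> S) \<le> s"
    and "\<And>s. s \<in> S \<Longrightarrow> s \<le> (GREATEST x. x \<in> S)"
proof -
  obtain a where a: "a \<in> S" "\<forall>s\<in>S. a \<le> s"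
    using compact_attains_inf[OF assms] by blast
  obtain b where b: "b \<in> S" "\<forall>s\<in>S. s \<le> b"
    using compact_attains_sup[OF assms] by blast
  have l: "(LEAST x. x \<in> S) = a" using a by (intro Least_equality) auto
  have g: "(GREATEST x. x \<in> S) = b" using b by (intro Greatest_equality) auto
  show "(LEAST x. x \<in> S) \<in> S" "(GREATEST x. x \<in> S) \<in> S"
    and "\<And>s. s \<in> S \<Longrightarrow> (LEAST x. x \<in> S) \<le> s"
    and "\<And>s. s \<in> S \<Longrightarrow> s \<le> (GREATEST x. x \<in> S)"
    using a b unfolding l g by auto
qed

lemma geometry_coord_extrema:
  assumes "geometry G"
  shows "fst (mbr_min G) \<in> fst ` G" "snd (mbr_min G) \<in> snd ` G"
    and "fst (mbr_max G) \<in> fst ` G" "snd (mbr_max G) \<in> snd ` G"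
    and "\<And>p. p \<in> G \<Longrightarrow> fst (mbr_min G) \<le> fst p \<and> fst p \<le> fst (mbr_max G)"
    and "\<And>p. p \<in> G \<Longrightarrow> snd (mbr_min G) \<le> snd p \<and> snd p \<le> snd (mbr_max G)"
proof -
  have G: "compact G" "G \<noteq> {}"
    using assms by (auto simp: geometry_def compact_eq_bounded_closed)
  have "compact (fst ` G)" "compact (snd ` G)"
    using G by (auto intro!: compact_continuous_image continuous_intros)
  note * = compact_Least_Greatest[OF this(1)] compact_Least_Greatest[OF this(2)]
  show "fst (mbr_min G) \<in> fst ` G" "snd (mbr_min G) \<in> snd ` G"
    and "fst (mbr_max G) \<in> fst ` G" "snd (mbr_max G) \<in> snd ` G"
    and "\<And>p. p \<in> G \<Longrightarrow> fst (mbr_min G) \<le> fst p \<and> fst p \<le> fst (mbr_max G)"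
    and "\<And>p. p \<in> G \<Longrightarrow> snd (mbr_min G) \<le> snd p \<and> snd p \<le> snd (mbr_max G)"
    unfolding mbr_min_def mbr_max_def fst_conv snd_conv
    using * G(2) by blast+
qed

text \<open>
  The interleaving sum runs over the finitely many positions where at least one of the two
  binary digits is nonzero.
\<close>

definition interleave :: "nat \<Rightarrow> nat \<Rightarrow> nat" where
  "interleave x y =
     (\<Sum>i | bit x i \<or> bit y i.
        of_bool (bit x i) * 2 ^ (2 * i) + of_bool (bit y i) * 2 ^ (2 * i + 1))"

lemma finite_bits_nat: "finite {i. bit (x :: nat) i \<or> bit (y :: nat) i}"
proof (rule finite_subset)
  have "i < n" if "bit n i" for n i :: nat
  proof (rule ccontr)
    assume "\<not> i < n"
    then have "n < 2 ^ i" using less_exp[of i] by linarith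
    then have "n div 2 ^ i = 0" by simp
    with that show False by (simp add: bit_iff_odd)
  qed
  then show "{i. bit x i \<or> bit y i} \<subseteq> {..<x + y}"
    by (fastforce intro: trans_less_add1 trans_less_add2)
qed simp

lemma "interleave 0 1 = 2"
  by (simp add: interleave_def bit_simps)

text \<open>The parameter \<open>c\<close> is the cell size, meant to be positive.\<close>

definition cell_x :: "real \<Rightarrow> real \<times> real \<Rightarrow> nat" where
  "cell_x c p = nat \<lfloor>(fst p + 180) / c\<rfloor>"

definition cell_y :: "real \<Rightarrow> real \<times> real \<Rightarrow> nat" where
  "cell_y c p = nat \<lfloor>(snd p + 90) / c\<rfloor>"

definition zaddress :: "real \<Rightarrow> real \<times> real \<Rightarrow> nat" where
  "zaddress c p = interleave (cell_x c p) (cell_y c p)"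

definition zmin :: "real \<Rightarrow> (real \<times> real) set \<Rightarrow> nat" where
  "zmin c G = zaddress c (mbr_min G)"

definition zmax :: "real \<Rightarrow> (real \<times> real) set \<Rightarrow> nat" where
  "zmax c G = zaddress c (mbr_max G)"

definition zitvl :: "real \<Rightarrow> (real \<times> real) set \<Rightarrow> nat set" where
  "zitvl c G = {zmin c G..zmax c G}"

end

theory Submission
  imports Defs
begin

text \<open>
  The Z-address of a point with cell coordinates \<open>(x, y)\<close> is \<open>s x + 2 * s y\<close>, where \<open>s\<close> reads
  binary digits in base 4 and is strictly increasing. Hence Z-addresses are monotone in both
  coordinates, and for a common point \<open>p\<close> of the two geometries the Z-address of \<open>p\<close> lies in
  both intervals.
\<close>

definition spread_bits :: "nat \<Rightarrow> nat" where
  "spread_bits n = (\<Sum>i | bit n i. 4 ^ i)"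

lemma finite_bit_set_nat: "finite {i. bit (n :: nat) i}"
  using finite_bits_nat[of n n] by simp

text \<open>Since \<open>2 ^ (2 * i) = 4 ^ i\<close>, the sum splits by coordinate; positions where
  only the other number has a 1 contribute zero.\<close>

lemma interleave_eq_spread_bits: "interleave x y = spread_bits x + 2 * spread_bits y"
proof -
  let ?A = "{i. bit x i \<or> bit y i}"
  have "(\<Sum>i\<in>?A. of_bool (bit x i) * 2 ^ (2 * i)) = spread_bits x"
    unfolding spread_bits_def
    by (rule sum.mono_neutral_cong_right) (auto simp: finite_bit_set_nat power_mult)
  moreover have "(\<Sum>i\<in>?A. of_bool (bit y i) * 2 ^ (2 * i + 1)) = 2 * spread_bits y"
    unfolding spread_bits_def sum_distrib_left
    by (rule sum.mono_neutral_cong_right) (auto simp: finite_bit_set_nat power_mult)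
  ultimately show ?thesis
    by (simp add: interleave_def sum.distrib)
qed

text \<open>The other digits of \<open>n\<close> are those of \<open>n div 2\<close>, moved up one
  position, which multiplies their base 4 value by 4.\<close>

lemma spread_bits_rec: "spread_bits n = n mod 2 + 4 * spread_bits (n div 2)"
proof -
  have "bit n i \<longleftrightarrow> (i = 0 \<and> odd n) \<or> i \<in> Suc ` {i. bit (n div 2) i}" for i
    by (cases i) (auto simp: bit_0 bit_Suc)
  then have eq: "{i. bit n i} = (if odd n then {0} else {}) \<union> Suc ` {i. bit (n div 2) i}"
    by auto
  have "spread_bits n = (if odd n then 1 else 0) + (\<Sum>i\<in>Suc ` {i. bit (n div 2) i}. 4 ^ i)"
    unfolding spread_bits_def eq
    by (subst sum.union_disjoint) (auto simp: finite_bit_set_nat)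
  also have "\<dots> = n mod 2 + 4 * spread_bits (n div 2)"
    by (simp add: spread_bits_def sum.reindex sum_distrib_left mod_2_eq_odd)
  finally show ?thesis .
qed

lemma strict_mono_spread_bits: "strict_mono spread_bits"
proof (rule strict_monoI)
  show "spread_bits m < spread_bits n" if "m < n" for m n
    using that
  proof (induction n arbitrary: m rule: less_induct)
    case (less n)
    show ?case
    proof (cases "m div 2 = n div 2")
      case True
      with less.prems have "m mod 2 < n mod 2" by presburger
      with True show ?thesis
        by (subst (1 2) spread_bits_rec) simp
    next
      case False
      with less.prems have "m div 2 < n div 2" by presburger
      with less.prems have "spread_bits (m div 2) < spread_bits (n div 2)"
        by (intro less.IH) auto
      \<comment> \<open>The higher digits gain at least 4, while the lowest digit loses at most
        1.\<close>
      moreover have "m mod 2 < 2" by simp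
      ultimately show ?thesis
        using spread_bits_rec[of m] spread_bits_rec[of n] by linarith
    qed
  qed
qed

lemma interleave_mono:
  assumes "x \<le> x'" "y \<le> y'"
  shows "interleave x y \<le> interleave x' y'"
  using assms strict_mono_less_eq[OF strict_mono_spread_bits]
  by (simp add: interleave_eq_spread_bits add_mono)

text \<open>Division by a positive \<open>c\<close>, floor and \<open>nat\<close> each preserve
  order, so cell coordinates do too.\<close>

lemma zaddress_mono:
  assumes "c > 0" "fst p \<le> fst q" "snd p \<le> snd q"
  shows "zaddress c p \<le> zaddress c q"
  unfolding zaddress_def cell_x_def cell_y_def
  using assms by (intro interleave_mono nat_mono floor_mono divide_right_mono) auto

lemma zaddress_in_zitvl:
  assumes "c > 0" "geometry G" "p \<in> G"
  shows "zaddress c p \<in> zitvl c G"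
  \<comment> \<open>Facts 5 and 6 place \<open>p\<close> coordinatewise between the two MBR
    corners.\<close>
  using geometry_coord_extrema(5,6)[OF assms(2,3)] assms(1)
  by (simp add: zitvl_def zmin_def zmax_def zaddress_mono)

theorem lemma2:
  fixes c :: real and Q GM :: "(real \<times> real) set"
  assumes "c > 0"
    and "geometry Q" and "geometry GM"
    and "intersects Q GM"
  shows "intersects (zitvl c Q) (zitvl c GM) \<and>
    zmin c Q \<le> zmax c GM \<and> zmax c Q \<ge> zmin c GM"
proof -
  obtain p where "p \<in> Q" "p \<in> GM"
    using assms(4) by (auto simp: intersects_def)
  then have "zaddress c p \<in> zitvl c Q" "zaddress c p \<in> zitvl c GM"
    using assms zaddress_in_zitvl by blast+
  then show ?thesis
    by (auto simp: intersects_def zitvl_def)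
qed

end
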